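(* Let $h$ and $k$ be positive integers. Then \[\{|hA| : A\subseteq\mathbb{N},\ |A|=k\}=\{|hA| : A\subseteq\mathbb{R},\ |A|=k\}=\{|A^h| : A\subseteq\mathbb{N},\ |A|=k\}=\{|A^h| : A\subseteq\mathbb{R},\ |A|=k\}.\]
   Context: $\mathbb{N}$ denotes the positive integers. For a finite set $A$ and positive integer $h$, the $h$-fold sumset is $hA=\{a_1+\dots+a_h : a_i\in A\}$ and the $h$-fold product set is $A^h=\{a_1\cdots a_h : a_i\in A\}$.
   Formalization: In the last set, A ranges over k-element sets of positive reals instead of all of ℝ; as printed the claim fails, e.g. h = k = 2 and A = {0,1} gives |A^2| = 2, while |2A| = 3 for every 2-element real set. *)

theory Defs
  imports Complex_Main
begin

definition sumset :: "nat \<Rightarrow> 'a::comm_monoid_add set \<Rightarrow> 'a set" where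
  "sumset h A = {(\<Sum>i<h. a i) | a. \<forall>i<h. a i \<in> A}"

definition prodset :: "nat \<Rightarrow> 'a::comm_monoid_mult set \<Rightarrow> 'a set" where
  "prodset h A = {(\<Prod>i<h. a i) | a. \<forall>i<h. a i \<in> A}"

text \<open>
  For product sets the real sets have to consist of positive numbers. If 0 or negative elements
  were admitted, \<open>A = {0, 1}\<close> would give a 2-fold product set of size 2, whereas the 2-fold
  sumset of a 2-element set of reals always has size 3.
\<close>

end

theory Submission
  imports Defs "HOL-Analysis.Kronecker_Approximation_Theorem"
begin

text \<open>
  The four sets are included in one another cyclically. From sums to products of natural numbers
  one passes via \<open>n \<mapsto> 2 ^ n\<close>, from products to sums of reals via the logarithm. The essential
  step turns a finite set \<open>A\<close> of reals into a set of integers with the same additive coincidences: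
  by Dirichlet's simultaneous approximation there are \<open>q \<ge> 1\<close> and integers \<open>p x\<close> with
  \<open>\<bar>q x - p x\<bar>\<close> tiny for all \<open>x \<in> A\<close>. Equal \<open>h\<close>-fold sums yield integers differing by less than 1,
  hence equal ones, and distinct \<open>h\<close>-fold sums are separated by some \<open>\<delta> > 0\<close>, hence by at least
  \<open>q \<delta> \<ge> \<delta>\<close> after scaling, which exceeds the approximation error. A translation makes the integers
  positive.
\<close>

text \<open>Sending the value \<open>s a\<close> to the value of \<open>t\<close> at
  \<open>f\<close> composed with \<open>a\<close> is well defined by one direction of
  \<open>iff\<close> and injective by the other. Keeping \<open>s\<close> and \<open>t\<close>
  abstract lets one argument serve every pairing of sums and products. Tuples are total functions
  constrained only below \<open>h\<close>, so \<open>t_cong\<close> is what makes \<open>t\<close> a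
  function of the first \<open>h\<close> entries.\<close>

lemma card_tuple_image_eq:
  fixes s :: "(nat \<Rightarrow> 'a) \<Rightarrow> 'c" and t :: "(nat \<Rightarrow> 'b) \<Rightarrow> 'd"
  assumes t_cong: "\<And>b c. (\<And>i. i < h \<Longrightarrow> b i = c i) \<Longrightarrow> t b = t c"
    and iff: "\<And>a b. \<forall>i<h. a i \<in> A \<Longrightarrow> \<forall>i<h. b i \<in> A \<Longrightarrow>
      s a = s b \<longleftrightarrow> t (\<lambda>i. f (a i)) = t (\<lambda>i. f (b i))"
  shows "card {t b | b. \<forall>i<h. b i \<in> f ` A} = card {s a | a. \<forall>i<h. a i \<in> A}"
proof -
  define T where "T = {a. \<forall>i<h. a i \<in> A}"
  let ?t = "\<lambda>a. t (\<lambda>i. f (a i))"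
  have "{t b | b. \<forall>i<h. b i \<in> f ` A} = ?t ` T"
  proof (intro equalityI subsetI)
    fix y assume "y \<in> {t b | b. \<forall>i<h. b i \<in> f ` A}"
    then obtain b where b: "y = t b" "\<forall>i<h. b i \<in> f ` A" by blast
    then obtain a where a: "\<forall>i<h. a i \<in> A \<and> b i = f (a i)"
      unfolding image_iff by metis
    then have "t b = ?t a" by (intro t_cong) simp
    with a b show "y \<in> ?t ` T" by (auto simp: T_def)
  qed (auto simp: T_def)
  moreover have "{s a | a. \<forall>i<h. a i \<in> A} = s ` T"
    by (auto simp: T_def)
  moreover have "bij_betw (\<lambda>x. ?t (inv_into T s x)) (s ` T) (?t ` T)"
  proof (rule bij_betw_imageI)
    \<comment> \<open>The value does not depend on which tuple \<open>inv_into\<close> picks as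
      representative of \<open>s a\<close>.\<close>
    have *: "?t (inv_into T s (s a)) = ?t a" if "a \<in> T" for a
    proof -
      have "inv_into T s (s a) \<in> T" "s (inv_into T s (s a)) = s a"
        using that by (auto simp: inv_into_into f_inv_into_f)
      with that show ?thesis using iff[of "inv_into T s (s a)" a] by (auto simp: T_def)
    qed
    then show "(\<lambda>x. ?t (inv_into T s x)) ` s ` T = ?t ` T"
      by (simp add: image_image cong: image_cong)
    show "inj_on (\<lambda>x. ?t (inv_into T s x)) (s ` T)"
    proof (rule inj_onI, elim imageE)
      fix x y a b
      assume ab: "x = s a" "a \<in> T" "y = s b" "b \<in> T"
        and "?t (inv_into T s x) = ?t (inv_into T s y)"
      then have "?t a = ?t b" by (simp only: *)
      with ab show "x = y" using iff[of a b] by (simp add: T_def)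
    qed
  qed
  ultimately show ?thesis by (simp add: bij_betw_same_card)
qed

lemma card_sumset_image_eq:
  assumes "\<And>a b. \<forall>i<h. a i \<in> A \<Longrightarrow> \<forall>i<h. b i \<in> A \<Longrightarrow>
    (\<Sum>i<h. a i) = (\<Sum>i<h. b i) \<longleftrightarrow> (\<Sum>i<h. f (a i)) = (\<Sum>i<h. f (b i))"
  shows "card (sumset h (f ` A)) = card (sumset h A)"
  unfolding sumset_def using assms by (intro card_tuple_image_eq sum.cong) auto

lemma card_prodset_image_eq_sumset:
  assumes "\<And>a b. \<forall>i<h. a i \<in> A \<Longrightarrow> \<forall>i<h. b i \<in> A \<Longrightarrow>
    (\<Sum>i<h. a i) = (\<Sum>i<h. b i) \<longleftrightarrow> (\<Prod>i<h. f (a i)) = (\<Prod>i<h. f (b i))"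
  shows "card (prodset h (f ` A)) = card (sumset h A)"
  unfolding sumset_def prodset_def using assms by (intro card_tuple_image_eq prod.cong) auto

lemma card_prodset_image_eq:
  assumes "\<And>a b. \<forall>i<h. a i \<in> A \<Longrightarrow> \<forall>i<h. b i \<in> A \<Longrightarrow>
    (\<Prod>i<h. a i) = (\<Prod>i<h. b i) \<longleftrightarrow> (\<Prod>i<h. f (a i)) = (\<Prod>i<h. f (b i))"
  shows "card (prodset h (f ` A)) = card (prodset h A)"
  unfolding prodset_def using assms by (intro card_tuple_image_eq prod.cong) auto

lemma card_sumset_ln_image:
  fixes A :: "real set"
  assumes "A \<subseteq> {0<..}"
  shows "card (sumset h (ln ` A)) = card (prodset h A)"
  unfolding sumset_def prodset_def
proof (intro card_tuple_image_eq sum.cong)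
  fix a b :: "nat \<Rightarrow> real"
  assume a: "\<forall>i<h. a i \<in> A" and b: "\<forall>i<h. b i \<in> A"
  \<comment> \<open>On positive reals \<open>ln\<close> is injective, so equal logarithms give back
    equal products.\<close>
  have pos: "(\<Prod>i<h. a i) > 0" "(\<Prod>i<h. b i) > 0"
    using a b assms by (auto intro!: prod_pos)
  have "(\<Sum>i<h. ln (a i)) = ln (\<Prod>i<h. a i)" "(\<Sum>i<h. ln (b i)) = ln (\<Prod>i<h. b i)"
    using a b assms by (subst ln_prod; force)+
  with pos show "(\<Prod>i<h. a i) = (\<Prod>i<h. b i) \<longleftrightarrow> (\<Sum>i<h. ln (a i)) = (\<Sum>i<h. ln (b i))"
    by simp
qed auto

lemma finite_sumset:
  assumes "finite A"
  shows "finite (sumset h A)"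
proof (rule finite_subset)
  \<comment> \<open>Restricting tuples to indices below \<open>h\<close> leaves every sum unchanged
    and replaces a possibly infinite set of functions by a finite one.\<close>
  show "sumset h A \<subseteq> (\<lambda>a. \<Sum>i<h. a i) ` ({..<h} \<rightarrow>\<^sub>E A)"
  proof
    fix x assume "x \<in> sumset h A"
    then obtain a where a: "x = (\<Sum>i<h. a i)" "\<forall>i<h. a i \<in> A"
      by (auto simp: sumset_def)
    then show "x \<in> (\<lambda>a. \<Sum>i<h. a i) ` ({..<h} \<rightarrow>\<^sub>E A)"
      by (intro image_eqI[where x = "restrict a {..<h}"]) auto
  qed
  show "finite ((\<lambda>a. \<Sum>i<h. a i) ` ({..<h} \<rightarrow>\<^sub>E A))"
    using assms by (intro finite_imageI finite_PiE) auto
qed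

lemma finite_set_simultaneous_approx:
  fixes A :: "real set"
  assumes "finite A" "\<epsilon> > 0"
  obtains q :: int and p :: "real \<Rightarrow> int" where "q > 0"
    "\<And>x. x \<in> A \<Longrightarrow> \<bar>of_int q * x - of_int (p x)\<bar> < \<epsilon>"
proof -
  \<comment> \<open>Dirichlet's theorem approximates an indexed family, so \<open>A\<close> is
    enumerated first and the numerators are pulled back to \<open>A\<close> afterwards.\<close>
  obtain g where g: "bij_betw g {0..<card A} A"
    using ex_bij_betw_nat_finite[OF \<open>finite A\<close>] by blast
  obtain N where N: "N > 0" "1 / real N < \<epsilon>"
    using real_arch_inverse[of \<epsilon>] assms(2) by (auto simp: inverse_eq_divide)
  obtain q p where q: "0 < q" "\<And>i. i < card A \<Longrightarrow> \<bar>of_int q * g i - of_int (p i)\<bar> < 1 / N"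
    using Dirichlet_approx_simult[OF N(1), of "card A" g] by metis
  define i where "i = inv_into {0..<card A} g"
  have "\<bar>of_int q * x - of_int (p (i x))\<bar> < \<epsilon>" if "x \<in> A" for x
  proof -
    have "i x < card A" "g (i x) = x"
      using that g bij_betw_inv_into_right[OF g that] inv_into_into[of x g "{0..<card A}"]
      by (auto simp: i_def bij_betw_def)
    with q(2)[of "i x"] N(2) show ?thesis by simp
  qed
  with q(1) show thesis by (rule that)
qed

lemma real_sums_integer_model:
  fixes A :: "real set" and h :: nat
  assumes "finite A" "h > 0"
  obtains p :: "real \<Rightarrow> int" where
    "\<And>a b. \<forall>i<h. a i \<in> A \<Longrightarrow> \<forall>i<h. b i \<in> A \<Longrightarrow>
      (\<Sum>i<h. a i) = (\<Sum>i<h. b i) \<longleftrightarrow> (\<Sum>i<h. p (a i)) = (\<Sum>i<h. p (b i))"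
proof -
  \<comment> \<open>A finite set of differences has a least nonzero absolute value; this provides
    the separation \<delta>.\<close>
  define D where "D = (\<lambda>(x, y). x - y) ` (sumset h A \<times> sumset h A)"
  have "finite D"
    using finite_sumset[OF \<open>finite A\<close>] by (simp add: D_def)
  then obtain \<delta> where \<delta>: "\<delta> > 0" "\<And>x. x \<in> D \<Longrightarrow> x \<noteq> 0 \<Longrightarrow> \<delta> \<le> \<bar>x\<bar>"
    using finite_set_avoid[of D 0] by (auto simp: dist_real_def)
  \<comment> \<open>Each scaled sum is within \<open>h * \<epsilon>\<close> of its integer, so
    comparing two sums costs at most \<open>2 * h * \<epsilon>\<close>. The bound 1 forces the
    integers of equal sums to agree; the bound \<delta> keeps distinct sums from sharing an
    integer.\<close>
  define \<epsilon> where "\<epsilon> = min 1 \<delta> / (2 * h)"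
  have "\<epsilon> > 0" and \<epsilon>: "2 * h * \<epsilon> \<le> 1" "2 * h * \<epsilon> \<le> \<delta>"
    using \<delta>(1) \<open>h > 0\<close> by (auto simp: \<epsilon>_def)
  obtain q :: int and p where "q > 0"
    and p: "\<And>x. x \<in> A \<Longrightarrow> \<bar>of_int q * x - of_int (p x)\<bar> < \<epsilon>"
    using finite_set_simultaneous_approx[OF \<open>finite A\<close> \<open>\<epsilon> > 0\<close>] by blast
  have approx: "\<bar>of_int q * (\<Sum>i<h. a i) - of_int (\<Sum>i<h. p (a i))\<bar> < h * \<epsilon>"
    if "\<forall>i<h. a i \<in> A" for a
  proof -
    have "\<bar>of_int q * (\<Sum>i<h. a i) - of_int (\<Sum>i<h. p (a i))\<bar>
        = \<bar>\<Sum>i<h. of_int q * a i - of_int (p (a i))\<bar>"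
      by (simp add: sum_subtractf sum_distrib_left)
    also have "\<dots> \<le> (\<Sum>i<h. \<bar>of_int q * a i - of_int (p (a i))\<bar>)"
      by (rule sum_abs)
    also have "\<dots> < (\<Sum>i<h. \<epsilon>)"
      using that p \<open>h > 0\<close> by (intro sum_strict_mono) auto
    finally show ?thesis by simp
  qed
  show thesis
  proof (rule that[of p])
    fix a b assume a: "\<forall>i<h. a i \<in> A" and b: "\<forall>i<h. b i \<in> A"
    let ?x = "\<Sum>i<h. a i" and ?y = "\<Sum>i<h. b i"
    let ?m = "\<Sum>i<h. p (a i)" and ?n = "\<Sum>i<h. p (b i)"
    show "?x = ?y \<longleftrightarrow> ?m = ?n"
    proof
      assume "?x = ?y"
      then have "real_of_int \<bar>?m - ?n\<bar> < 1"
        using approx[OF a] approx[OF b] \<epsilon>(1) by (simp del: of_int_sum)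
      then show "?m = ?n" by linarith
    next
      assume mn: "?m = ?n"
      show "?x = ?y"
      proof (rule ccontr)
        assume "?x \<noteq> ?y"
        moreover have "?x - ?y \<in> D"
          using a b by (force simp: D_def sumset_def)
        ultimately have "\<delta> \<le> \<bar>?x - ?y\<bar>" using \<delta>(2) by simp
        \<comment> \<open>A positive integer \<open>q\<close> is at least 1, so scaling cannot
          shrink the gap.\<close>
        also have "\<dots> \<le> of_int q * \<bar>?x - ?y\<bar>"
          using \<open>q > 0\<close> by (simp add: mult_le_cancel_right1)
        also have "\<dots> = \<bar>of_int q * ?x - of_int q * ?y\<bar>"
          using \<open>q > 0\<close> by (simp add: abs_mult flip: right_diff_distrib)
        also have "\<dots> < 2 * h * \<epsilon>"
          using approx[OF a] approx[OF b] mn by (simp del: of_int_sum)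
        finally show False using \<epsilon>(2) by simp
      qed
    qed
  qed
qed

lemma real_sums_positive_nat_model:
  fixes A :: "real set" and h :: nat
  assumes "finite A" "h > 0"
  obtains f :: "real \<Rightarrow> nat" where "f ` A \<subseteq> {0<..}" "inj_on f A"
    "card (sumset h (f ` A)) = card (sumset h A)"
proof -
  obtain p :: "real \<Rightarrow> int" where p: "\<And>a b. \<forall>i<h. a i \<in> A \<Longrightarrow> \<forall>i<h. b i \<in> A \<Longrightarrow>
      (\<Sum>i<h. a i) = (\<Sum>i<h. b i) \<longleftrightarrow> (\<Sum>i<h. p (a i)) = (\<Sum>i<h. p (b i))"
    using real_sums_integer_model[OF assms] by blast
  \<comment> \<open>\<open>M\<close> exceeds every \<bar>p x\<bar> on \<open>A\<close>, so
    \<open>nat\<close> truncates nothing. The shift adds the same \<open>h * M\<close> to every sum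
    of \<open>h\<close> terms and so preserves all coincidences.\<close>
  define M where "M = 1 + (\<Sum>x\<in>A. \<bar>p x\<bar>)"
  define f where "f = (\<lambda>x. nat (p x + M))"
  have pos: "p x + M > 0" if "x \<in> A" for x
    using member_le_sum[of x A "\<lambda>x. \<bar>p x\<bar>"] that \<open>finite A\<close> by (auto simp: M_def)
  have int_f: "int (f x) = p x + M" if "x \<in> A" for x
    using pos[OF that] by (simp add: f_def)
  have sum_f: "int (\<Sum>i<h. f (a i)) = (\<Sum>i<h. p (a i)) + int h * M" if "\<forall>i<h. a i \<in> A" for a
    using that by (simp add: int_f sum.distrib)
  have iff: "(\<Sum>i<h. a i) = (\<Sum>i<h. b i) \<longleftrightarrow> (\<Sum>i<h. f (a i)) = (\<Sum>i<h. f (b i))"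
    if "\<forall>i<h. a i \<in> A" "\<forall>i<h. b i \<in> A" for a b
    using p[OF that] sum_f[OF that(1)] sum_f[OF that(2)] by linarith
  show thesis
  proof
    show "f ` A \<subseteq> {0<..}" using pos by (auto simp: f_def)
    show "inj_on f A"
    proof (rule inj_onI)
      fix x y assume "x \<in> A" "y \<in> A" "f x = f y"
      \<comment> \<open>Constant tuples turn \<open>f x = f y\<close> into
        \<open>h * x = h * y\<close>, and \<open>h\<close> is nonzero.\<close>
      then show "x = y" using iff[of "\<lambda>_. x" "\<lambda>_. y"] \<open>h > 0\<close> by simp
    qed
    show "card (sumset h (f ` A)) = card (sumset h A)"
      by (rule card_sumset_image_eq) (rule iff)
  qed
qed

theorem theorem2:
  fixes h k :: nat
  assumes "h > 0" and "k > 0"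
  shows "{card (sumset h A) | A :: nat set. A \<subseteq> {0<..} \<and> card A = k}
           = {card (sumset h A) | A :: real set. card A = k}
       \<and> {card (sumset h A) | A :: real set. card A = k}
           = {card (prodset h A) | A :: nat set. A \<subseteq> {0<..} \<and> card A = k}
       \<and> {card (prodset h A) | A :: nat set. A \<subseteq> {0<..} \<and> card A = k}
           = {card (prodset h A) | A :: real set. A \<subseteq> {0<..} \<and> card A = k}"
    (is "?SN = ?SR \<and> ?SR = ?PN \<and> ?PN = ?PR")
proof -
  have "?SN \<subseteq> ?PN"
  proof clarify
    fix A :: "nat set" assume "A \<subseteq> {0<..}" "k = card A"
    have "card (prodset h ((^) (2::nat) ` A)) = card (sumset h A)"
      \<comment> \<open>A product of powers of 2 is 2 to the sum of the exponents, and it determines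
        that sum.\<close>
      by (rule card_prodset_image_eq_sumset) (simp flip: power_sum)
    moreover have "card ((^) (2::nat) ` A) = card A"
      by (intro card_image inj_onI) simp
    moreover have "(^) (2::nat) ` A \<subseteq> {0<..}" by auto
    ultimately show "\<exists>B::nat set. card (sumset h A) = card (prodset h B) \<and>
        B \<subseteq> {0<..} \<and> card B = card A"
      by (intro exI[of _ "(^) 2 ` A"]) simp
  qed
  moreover have "?PN \<subseteq> ?PR"
  proof clarify
    fix A :: "nat set" assume "A \<subseteq> {0<..}" "k = card A"
    have "card (prodset h (real ` A)) = card (prodset h A)"
      by (rule card_prodset_image_eq) (simp flip: of_nat_prod)
    moreover have "card (real ` A) = card A"
      by (intro card_image inj_onI) simp
    moreover have "real ` A \<subseteq> {0<..}" using \<open>A \<subseteq> {0<..}\<close> by auto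
    ultimately show "\<exists>B::real set. card (prodset h A) = card (prodset h B) \<and>
        B \<subseteq> {0<..} \<and> card B = card A"
      by (intro exI[of _ "real ` A"]) simp
  qed
  moreover have "?PR \<subseteq> ?SR"
  proof clarify
    fix A :: "real set" assume "A \<subseteq> {0<..}" "k = card A"
    moreover from this have "card (ln ` A) = card A"
      by (intro card_image inj_onI) (metis greaterThan_iff ln_inj_iff subsetD)
    ultimately show "\<exists>B::real set. card (prodset h A) = card (sumset h B) \<and> card B = card A"
      by (intro exI[of _ "ln ` A"]) (simp add: card_sumset_ln_image)
  qed
  moreover have "?SR \<subseteq> ?SN"
  proof clarify
    fix A :: "real set" assume "k = card A"
    \<comment> \<open>Infinite sets have \<open>card\<close> equal to 0, so positivity of
      \<open>k\<close> rules them out.\<close>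
    with \<open>k > 0\<close> have "finite A" by (simp add: card_gt_0_iff)
    then obtain f :: "real \<Rightarrow> nat" where "f ` A \<subseteq> {0<..}" "inj_on f A"
      "card (sumset h (f ` A)) = card (sumset h A)"
      using real_sums_positive_nat_model \<open>h > 0\<close> by blast
    then show "\<exists>B::nat set. card (sumset h A) = card (sumset h B) \<and>
        B \<subseteq> {0<..} \<and> card B = card A"
      by (intro exI[of _ "f ` A"]) (simp add: card_image)
  qed
  ultimately show ?thesis
    by (meson subset_antisym subset_trans)
qed

end
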